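(* A linear operator $T:\mathbb C[z]\to\mathbb C[z]$ preserves stability (i.e. $T(\mathcal H_1(\mathbb C))\subseteq\mathcal H_1(\mathbb C)\cup\{0\}$) if and only if either (a) $T$ has range of dimension at most one and $T(f)=\alpha(f)P$ for $f\in\mathbb C[z]$, where $\alpha:\mathbb C[z]\to\mathbb C$ is a linear functional and $P\in\mathcal H_1(\mathbb C)$; or (b) $G_T(z,w)\in\overline{\mathcal H}_2(\mathbb C)$.
   Context: A polynomial in $k$ variables is stable if it is non-zero and does not vanish when all variables have positive imaginary part; $\mathcal H_k(\mathbb C)$ is the set of these and $\overline{\mathcal H}_k(\mathbb C)$ is the set of entire functions in $k$ variables that are limits, uniformly on compact subsets of $\mathbb C^k$, of polynomials in $\mathcal H_k(\mathbb C)$. For a linear operator $T$ on $\mathbb C[z]$, $G_T(z,w)=\sum_{n=0}^\infty\frac{(-1)^nT(z^n)}{n!}w^n\in\mathbb C[z][[w]]$; membership in $\overline{\mathcal H}_2(\mathbb C)$ means this series defines such an entire function. *)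

theory Defs
  imports "HOL-Analysis.Analysis" "HOL-Computational_Algebra.Polynomial"
begin

definition stable1 :: "complex poly \<Rightarrow> bool" where
  "stable1 p \<longleftrightarrow> p \<noteq> 0 \<and> (\<forall>z. Im z > 0 \<longrightarrow> poly p z \<noteq> 0)"

text \<open>Bivariate polynomials in z and w are represented as polynomials in w whose
  coefficients are polynomials in z.\<close>
definition eval2 :: "complex poly poly \<Rightarrow> complex \<Rightarrow> complex \<Rightarrow> complex" where
  "eval2 q z w = poly (map_poly (\<lambda>c. poly c z) q) w"

definition stable2 :: "complex poly poly \<Rightarrow> bool" where
  "stable2 q \<longleftrightarrow> q \<noteq> 0 \<and> (\<forall>z w. Im z > 0 \<longrightarrow> Im w > 0 \<longrightarrow> eval2 q z w \<noteq> 0)"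

definition stable2_closure :: "(complex \<times> complex \<Rightarrow> complex) set" where
  "stable2_closure = {F. \<exists>p :: nat \<Rightarrow> complex poly poly. (\<forall>k. stable2 (p k)) \<and>
      (\<forall>K. compact K \<longrightarrow>
         uniform_limit K (\<lambda>k zw. eval2 (p k) (fst zw) (snd zw)) F sequentially)}"

definition linear_op :: "(complex poly \<Rightarrow> complex poly) \<Rightarrow> bool" where
  "linear_op T \<longleftrightarrow> (\<forall>p q. T (p + q) = T p + T q) \<and> (\<forall>c p. T (smult c p) = smult c (T p))"

definition linear_functional :: "(complex poly \<Rightarrow> complex) \<Rightarrow> bool" where
  "linear_functional \<alpha> \<longleftrightarrow> (\<forall>p q. \<alpha> (p + q) = \<alpha> p + \<alpha> q) \<and> (\<forall>c p. \<alpha> (smult c p) = c * \<alpha> p)"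

definition GT_term :: "(complex poly \<Rightarrow> complex poly) \<Rightarrow> complex \<Rightarrow> complex \<Rightarrow> nat \<Rightarrow> complex" where
  "GT_term T z w n = ((-1) ^ n / fact n) * poly (T (monom 1 n)) z * w ^ n"

definition GT_in_closure :: "(complex poly \<Rightarrow> complex poly) \<Rightarrow> bool" where
  "GT_in_closure T \<longleftrightarrow> (\<exists>F \<in> stable2_closure. \<forall>z w. GT_term T z w sums F (z, w))"

end

theory Submission
  imports Defs "HOL-Complex_Analysis.Complex_Analysis"
    "HOL-Computational_Algebra.Fundamental_Theorem_Algebra"
begin

text \<open>
  If \<open>G\<^sub>T\<close> is a limit of stable polynomials \<open>p\<^sub>k\<close>, then \<open>T(f)(z) = f(-\<partial>/\<partial>w) G\<^sub>T(z,w)\<close> at \<open>w = 0\<close>.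
  Applying \<open>f(-\<partial>/\<partial>w)\<close> to \<open>p\<^sub>k\<close> keeps it zero-free, since the logarithmic derivative of a
  polynomial maps a half plane free of zeros to the opposite one, and Hurwitz' theorem
  passes to the limit.

  Conversely, let \<open>P\<^sub>n(z,w) = T[(1 - xw/n)\<^sup>n](z)\<close>, a termwise damped truncation of \<open>G\<^sub>T\<close>. If
  \<open>T[(1 - xw/n)\<^sup>n] = 0\<close> for infinitely many \<open>n\<close> and suitable \<open>w\<close> in the upper half plane, then,
  as small perturbations of \<open>(1 - xw/n)\<^sup>n\<close> are stable, the whole range of \<open>T\<close> consists of stable
  polynomials and 0; such a space has dimension at most one, because some combination of two
  of its elements vanishes at \<open>\<i>\<close>. Otherwise \<open>P\<^sub>n\<close> is stable for large \<open>n\<close>. Szasz' inequality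
  bounds a stable polynomial by three consecutive coefficients, starting with the first
  nonzero one; applied first in \<open>w\<close> for \<open>z\<close> in the upper half plane and then along diagonal lines
  of \<open>\<complex>\<^sup>2\<close>, it bounds \<open>P\<^sub>n\<close> uniformly on compact sets, so that \<open>P\<^sub>n\<close> converges to \<open>G\<^sub>T\<close>.
\<close>

lemma eval2_conv_poly: "eval2 q z w = poly (poly q [:w:]) z"
  unfolding eval2_def by (induction q) (auto simp: map_poly_pCons algebra_simps)

section \<open>Szasz' inequality\<close>

text \<open>As \<open>p\<close> does not vanish at 0, each root r can be divided out in the form 1 -
  x/r. With reciprocal roots as parameters, the coefficients of lowest order become symmetric
  functions of the zeros.\<close>

lemma poly_factor_at_0:
  fixes p :: "complex poly"
  assumes "coeff p 0 \<noteq> 0"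
  shows "\<exists>us. p = smult (coeff p 0) (\<Prod>u\<leftarrow>us. [:1, -u:]) \<and> (\<forall>u\<in>set us. u \<noteq> 0 \<and> poly p (1 / u) = 0)"
  using assms
proof (induction "degree p" arbitrary: p)
  case 0
  then obtain a where "p = [:a:]" by (metis degree_eq_zeroE)
  then show ?case by (intro exI[of _ "[]"]) auto
next
  case (Suc n)
  obtain r where r: "poly p r = 0"
    using alg_closed_imp_poly_has_root[of p] Suc.hyps(2) by auto
  have "r \<noteq> 0" using r Suc.prems by (metis poly_0_coeff_0)
  obtain q where q: "p = [:-r, 1:] * q" using r by (auto simp: poly_eq_0_iff_dvd)
  have "q \<noteq> 0" using q Suc.prems by auto
  then have "degree p = degree [:-r, 1:] + degree q" unfolding q by (intro degree_mult_eq) auto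
  then have dq: "n = degree q" using Suc.hyps(2) by simp
  have c0: "coeff p 0 = - r * coeff q 0" unfolding q by (simp add: coeff_mult)
  then have "coeff q 0 \<noteq> 0" using Suc.prems by auto
  from Suc.hyps(1)[OF dq this] obtain us
    where us: "q = smult (coeff q 0) (\<Prod>u\<leftarrow>us. [:1, -u:])"
      "\<forall>u\<in>set us. u \<noteq> 0 \<and> poly q (1 / u) = 0" by auto
  have "[:-r, 1:] = smult (-r) [:1, -(1/r):]" using \<open>r \<noteq> 0\<close> by simp
  then have "p = smult (-r) [:1, -(1/r):] * q" using q by metis
  also have "\<dots> = smult (coeff p 0) (\<Prod>u\<leftarrow>(1/r) # us. [:1, -u:])"
    unfolding c0 by (subst us(1)) (simp only: list.map prod_list.Cons mult_smult_left mult_smult_right smult_smult mult.commute)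
  finally have "p = smult (coeff p 0) (\<Prod>u\<leftarrow>(1/r) # us. [:1, -u:])" .
  moreover have "\<forall>u\<in>set ((1/r) # us). u \<noteq> 0 \<and> poly p (1 / u) = 0"
    using us(2) \<open>r \<noteq> 0\<close> r q by auto
  ultimately show ?case by blast
qed

text \<open>Newton's identities for the first two power sums. Through them the coefficients of index
  1 and 2 control the sums of u and of u^2.\<close>

lemma coeff_prod_linear:
  fixes us :: "complex list"
  defines "p \<equiv> (\<Prod>u\<leftarrow>us. [:1, -u:])"
  shows "coeff p 0 = 1" "coeff p 1 = - sum_list us"
    "2 * coeff p 2 = (sum_list us)\<^sup>2 - (\<Sum>u\<leftarrow>us. u\<^sup>2)"
proof -
  have "coeff p 0 = 1 \<and> coeff p 1 = - sum_list us \<and>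
    2 * coeff p 2 = (sum_list us)\<^sup>2 - (\<Sum>u\<leftarrow>us. u\<^sup>2)"
    unfolding p_def
  proof (induction us)
    case (Cons u us)
    define q where "q = (\<Prod>u\<leftarrow>us. [:1, -u:])"
    have "coeff ([:1, -u:] * q) 0 = coeff q 0" 
      "coeff ([:1, -u:] * q) 1 = coeff q 1 - u * coeff q 0"
      "coeff ([:1, -u:] * q) 2 = coeff q 2 - u * coeff q 1"
      by (simp_all add: numeral_2_eq_2)
    then show ?case using Cons.IH unfolding list.map prod_list.Cons q_def[symmetric]
      by (simp add: power2_eq_square algebra_simps)
  qed (auto simp: numeral_2_eq_2)
  then show "coeff p 0 = 1" "coeff p 1 = - sum_list us"
    "2 * coeff p 2 = (sum_list us)\<^sup>2 - (\<Sum>u\<leftarrow>us. u\<^sup>2)" by auto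
qed

text \<open>The inequality 1 + t \<le> exp t is applied to |1 - wu|^2 rather than to |1 - wu|. This
  retains the term Re(wu), so that the sum of the u enters and not the sum of their norms.\<close>

lemma norm_prod_linear_le:
  fixes us :: "complex list"
  shows "norm (poly (\<Prod>u\<leftarrow>us. [:1, -u:]) w) \<le>
    exp (- Re (w * sum_list us) + (norm w)\<^sup>2 / 2 * (\<Sum>u\<leftarrow>us. (norm u)\<^sup>2))"
proof (induction us)
  case (Cons u us)
  have "(norm (1 - w * u))\<^sup>2 = 1 + (- 2 * Re (w * u) + (norm (w * u))\<^sup>2)"
    by (simp only: cmod_power2) (simp add: power2_eq_square algebra_simps)
  also have "\<dots> \<le> exp (- 2 * Re (w * u) + (norm (w * u))\<^sup>2)"
    by (rule exp_ge_add_one_self)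
  also have "\<dots> = (exp (- Re (w * u) + (norm w)\<^sup>2 / 2 * (norm u)\<^sup>2))\<^sup>2"
    by (simp add: norm_mult power_mult_distrib flip: exp_double)
  finally have 1: "norm (1 - w * u) \<le> exp (- Re (w * u) + (norm w)\<^sup>2 / 2 * (norm u)\<^sup>2)"
    by (rule power2_le_imp_le) auto
  have "norm (poly (\<Prod>u\<leftarrow>u # us. [:1, -u:]) w) = norm (1 - w * u) * norm (poly (\<Prod>u\<leftarrow>us. [:1, -u:]) w)"
    by (simp add: algebra_simps flip: norm_mult)
  also have "\<dots> \<le> exp (- Re (w * u) + (norm w)\<^sup>2 / 2 * (norm u)\<^sup>2) *
     exp (- Re (w * sum_list us) + (norm w)\<^sup>2 / 2 * (\<Sum>u\<leftarrow>us. (norm u)\<^sup>2))"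
    by (intro mult_mono 1 Cons.IH) auto
  also have "\<dots> = exp (- Re (w * sum_list (u # us)) + (norm w)\<^sup>2 / 2 * (\<Sum>u\<leftarrow>u # us. (norm u)\<^sup>2))"
    by (subst exp_add[symmetric], rule arg_cong[where f = exp]) (simp add: algebra_simps)
  finally show ?case .
qed auto

text \<open>Here the half plane enters: |u|^2 = Re(u^2) + 2 (Im u)^2, and for numbers of one sign
  the sum of squares is at most the square of the sum.\<close>

lemma sum_list_norm_squares_le:
  fixes us :: "complex list"
  assumes "\<forall>u\<in>set us. Im u \<ge> 0"
  shows "(\<Sum>u\<leftarrow>us. (norm u)\<^sup>2) \<le> Re (\<Sum>u\<leftarrow>us. u\<^sup>2) + 2 * (Im (sum_list us))\<^sup>2"
    and "Im (sum_list us) \<ge> 0"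
proof -
  have "(\<Sum>u\<leftarrow>us. (norm u)\<^sup>2) \<le> Re (\<Sum>u\<leftarrow>us. u\<^sup>2) + 2 * (Im (sum_list us))\<^sup>2 \<and> Im (sum_list us) \<ge> 0"
    using assms
  proof (induction us)
    case (Cons u us)
    have "(norm u)\<^sup>2 = Re (u\<^sup>2) + 2 * (Im u)\<^sup>2"
      by (simp only: cmod_power2) (simp add: power2_eq_square)
    moreover have "(Im u + Im (sum_list us))\<^sup>2 \<ge> (Im u)\<^sup>2 + (Im (sum_list us))\<^sup>2"
      using Cons by (simp add: power2_sum)
    ultimately show ?case using Cons by auto
  qed auto
  then show "(\<Sum>u\<leftarrow>us. (norm u)\<^sup>2) \<le> Re (\<Sum>u\<leftarrow>us. u\<^sup>2) + 2 * (Im (sum_list us))\<^sup>2"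
    "Im (sum_list us) \<ge> 0" by auto
qed

text \<open>All zeros lie in the closed lower half plane, so their reciprocals u have nonnegative
  imaginary part. \<open>B1\<close> bounds the sum of the u, \<open>B1\<close> and \<open>B2\<close>
  bound the sum of the u^2, and one-sidedness then bounds the sum of the |u|^2. The degree does not
  enter.\<close>

lemma Szasz_inequality_0:
  fixes p :: "complex poly"
  assumes nz: "\<And>w. Im w > 0 \<Longrightarrow> poly p w \<noteq> 0"
    and c0: "coeff p 0 \<noteq> 0"
    and B1: "norm (coeff p 1) \<le> B1 * norm (coeff p 0)"
    and B2: "norm (coeff p 2) \<le> B2 * norm (coeff p 0)"
  shows "norm (poly p w) \<le> norm (coeff p 0) * exp (B1 * norm w + (3 * B1\<^sup>2 + 2 * B2) / 2 * (norm w)\<^sup>2)"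
proof -
  obtain us where p: "p = smult (coeff p 0) (\<Prod>u\<leftarrow>us. [:1, -u:])"
    and us: "\<forall>u\<in>set us. u \<noteq> 0 \<and> poly p (1 / u) = 0"
    using poly_factor_at_0[OF c0] by blast
  define c where "c = coeff p 0"
  define q where "q = (\<Prod>u\<leftarrow>us. [:1, -u:])"
  have p': "p = smult c q" using p unfolding q_def c_def .
  have im: "Im u \<ge> 0" if "u \<in> set us" for u
  proof (rule ccontr)
    assume "\<not> Im u \<ge> 0"
    then have "Im (1 / u) > 0"
      by (simp add: Im_divide divide_simps) (smt (verit) sum_power2_gt_zero_iff)
    then show False using nz us that by blast
  qed
  have S: "norm (sum_list us) \<le> B1"
  proof -
    have "norm c * norm (sum_list us) \<le> norm c * B1"
      using B1 coeff_prod_linear(2)[of us] unfolding c_def[symmetric] unfolding p' 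
      by (simp add: norm_mult q_def mult.commute)
    then show ?thesis using c0 unfolding c_def by simp
  qed
  have S2: "norm (\<Sum>u\<leftarrow>us. u\<^sup>2) \<le> B1\<^sup>2 + 2 * B2"
  proof -
    have "norm c * norm (coeff q 2) \<le> norm c * B2"
      using B2 unfolding c_def[symmetric] unfolding p' by (simp add: norm_mult mult.commute)
    then have "norm (coeff q 2) \<le> B2" using c0 unfolding c_def by simp
    moreover have "(\<Sum>u\<leftarrow>us. u\<^sup>2) = (sum_list us)\<^sup>2 - 2 * coeff q 2"
      using coeff_prod_linear(3)[of us] unfolding q_def by simp
    moreover have "norm ((sum_list us)\<^sup>2) \<le> B1\<^sup>2"
      unfolding norm_power by (intro power_mono S) auto
    ultimately show ?thesis
      using norm_triangle_ineq4[of "(sum_list us)\<^sup>2" "2 * coeff q 2"] by (simp add: norm_mult)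
  qed
  have "(Im (sum_list us))\<^sup>2 \<le> B1\<^sup>2"
    using S abs_Im_le_cmod[of "sum_list us"] sum_list_norm_squares_le(2)[of us] im
    by (intro power_mono) auto
  \<comment> \<open>\<open>B1\<^sup>2 + 2 * B2\<close> comes from the sum of the u^2, and a further
    \<open>2 * B1\<^sup>2\<close> from the imaginary parts.\<close>
  then have Q: "(\<Sum>u\<leftarrow>us. (norm u)\<^sup>2) \<le> 3 * B1\<^sup>2 + 2 * B2"
    using sum_list_norm_squares_le(1)[of us] im S2 complex_Re_le_cmod[of "\<Sum>u\<leftarrow>us. u\<^sup>2"] by auto
  have "norm (poly p w) = norm c * norm (poly q w)" by (simp add: p' norm_mult)
  also have "norm (poly q w) \<le> exp (- Re (w * sum_list us) + (norm w)\<^sup>2 / 2 * (\<Sum>u\<leftarrow>us. (norm u)\<^sup>2))"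
    unfolding q_def by (rule norm_prod_linear_le)
  also have "\<dots> \<le> exp (B1 * norm w + (3 * B1\<^sup>2 + 2 * B2) / 2 * (norm w)\<^sup>2)"
  proof -
    have "- Re (w * sum_list us) \<le> norm (w * sum_list us)"
      using complex_Re_le_cmod[of "- (w * sum_list us)"] by simp
    also have "\<dots> \<le> B1 * norm w"
      using mult_left_mono[OF S, of "norm w"] by (simp add: norm_mult mult.commute)
    finally show ?thesis using mult_left_mono[OF Q, of "(norm w)\<^sup>2 / 2"]
      by (simp add: mult.commute)
  qed
  finally show ?thesis
    unfolding c_def by (simp add: mult_left_mono)
qed

text \<open>The factor x^m has no zero in the upper half plane, so dividing by it leads to the case
  of a nonzero constant coefficient.\<close>

lemma Szasz_inequality:
  fixes p :: "complex poly"
  assumes nz: "\<And>w. Im w > 0 \<Longrightarrow> poly p w \<noteq> 0"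
    and low: "\<And>k. k < m \<Longrightarrow> coeff p k = 0"
    and cm: "coeff p m \<noteq> 0"
    and B1: "norm (coeff p (m + 1)) \<le> B1 * norm (coeff p m)"
    and B2: "norm (coeff p (m + 2)) \<le> B2 * norm (coeff p m)"
  shows "norm (poly p w) \<le> norm w ^ m * norm (coeff p m) *
    exp (B1 * norm w + (3 * B1\<^sup>2 + 2 * B2) / 2 * (norm w)\<^sup>2)"
proof -
  obtain q where q: "p = monom 1 m * q"
    using low monom_1_dvd_iff'[of m p] by (auto elim: dvdE)
  have c: "coeff p (m + j) = coeff q j" for j unfolding q by (simp add: coeff_monom_mult)
  have "norm (poly q w) \<le> norm (coeff q 0) * exp (B1 * norm w + (3 * B1\<^sup>2 + 2 * B2) / 2 * (norm w)\<^sup>2)"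
    using nz cm B1 B2 c[of 0]
    by (intro Szasz_inequality_0) (auto simp: q poly_monom simp flip: c)
  then have "norm w ^ m * norm (poly q w) \<le> norm w ^ m * (norm (coeff q 0) * exp (B1 * norm w + (3 * B1\<^sup>2 + 2 * B2) / 2 * (norm w)\<^sup>2))"
    by (intro mult_left_mono) auto
  then show ?thesis using c[of 0] by (simp add: q poly_monom norm_mult norm_power)
qed

text \<open>Cauchy's inequality for a function known only through an everywhere convergent series,
  so that it serves polynomials and differences from their limits alike.\<close>

lemma norm_powser_coeff_le:
  fixes a :: "nat \<Rightarrow> complex"
  assumes sums: "\<And>w. (\<lambda>n. a n * w ^ n) sums f w"
    and "r > 0" and bd: "\<And>w. norm w = r \<Longrightarrow> norm (f w) \<le> B"
  shows "norm (a n) * r ^ n \<le> B"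
proof -
  have hol: "f holomorphic_on ball 0 R" for R
    using sums by (intro power_series_holomorphic[where a = a]) auto
  have hU: "f holomorphic_on UNIV"
    using sums hol by (meson UNIV_I centre_in_ball gt_ex holomorphic_on_def
       field_differentiable_at_within holomorphic_on_imp_differentiable_at open_ball 
       mem_ball_0)
  have exp: "f has_fps_expansion Abs_fps a"
    using sums by (intro has_fps_expansionI) auto
  have "(deriv ^^ n) f 0 = fact n * a n"
    using fps_nth_fps_expansion[OF exp, of n] by simp
  moreover have "norm ((deriv ^^ n) f 0) \<le> fact n * B / r ^ n"
    using hU \<open>r > 0\<close> bd
    by (intro Cauchy_inequality) (auto intro: holomorphic_on_subset holomorphic_on_imp_continuous_on)
  ultimately show ?thesis using \<open>r > 0\<close> by (simp add: norm_mult field_simps)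
qed

section \<open>Sufficiency of the symbol condition\<close>

text \<open>g'/g is the sum of 1/(w - r) over the roots r, and Im r < 0 \<le> Im w puts every term
  in the closed lower half plane. The induction splits off one root at a time.\<close>

lemma Im_log_deriv_nonpos:
  fixes g :: "complex poly"
  assumes "\<And>w. Im w \<ge> 0 \<Longrightarrow> poly g w \<noteq> 0" "Im w \<ge> 0"
  shows "Im (poly (pderiv g) w / poly g w) \<le> 0"
  using assms
proof (induction "degree g" arbitrary: g)
  case 0
  then obtain a where "g = [:a:]" by (metis degree_eq_zeroE)
  then show ?case by (simp add: pderiv_pCons)
next
  case (Suc n)
  obtain r where r: "poly g r = 0"
    using alg_closed_imp_poly_has_root[of g] Suc.hyps(2) by auto
  then obtain h where h: "g = [:-r, 1:] * h" by (auto simp: poly_eq_0_iff_dvd)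
  have "h \<noteq> 0" using h Suc.hyps(2) by auto
  then have "degree g = degree [:-r, 1:] + degree h" unfolding h by (intro degree_mult_eq) auto
  then have dh: "n = degree h" using Suc.hyps(2) by simp
  have hz: "poly h w \<noteq> 0" if "Im w \<ge> 0" for w using Suc.prems(1)[OF that] by (simp add: h)
  have rw: "w - r \<noteq> 0" using Suc.prems(1)[OF Suc.prems(2)] by (auto simp: h)
  have dg: "pderiv g = h + [:-r, 1:] * pderiv h"
    unfolding h by (simp only: pderiv_mult) (simp add: pderiv_pCons)
  have pd: "poly (pderiv g) w = poly h w + (w - r) * poly (pderiv h) w"
    unfolding dg by (simp add: algebra_simps)
  have gw: "poly g w = (w - r) * poly h w" by (simp add: h algebra_simps)
  have "Im r < 0" using Suc.prems(1)[of r] r by force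
  then have "Im (1 / (w - r)) \<le> 0"
    using Suc.prems(2) by (simp add: Im_divide divide_nonpos_nonneg)
  moreover have "poly (pderiv g) w / poly g w = 1 / (w - r) + poly (pderiv h) w / poly h w"
    using rw hz[OF Suc.prems(2)] unfolding pd gw by (simp add: divide_simps)
  ultimately show ?case using Suc.hyps(1)[OF dh hz Suc.prems(2)] by simp
qed

text \<open>Up to sign this is one linear factor of f(-d/dw), with \<open>x\<close> a root of f. At
  a zero, g'/g = -x would have positive imaginary part.\<close>

lemma pderiv_plus_smult_nonzero:
  fixes g :: "complex poly"
  assumes "\<And>w. Im w \<ge> 0 \<Longrightarrow> poly g w \<noteq> 0" "Im w \<ge> 0" "Im x < 0"
  shows "poly (pderiv g + smult x g) w \<noteq> 0"
proof
  assume "poly (pderiv g + smult x g) w = 0"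
  then have "poly (pderiv g) w / poly g w = - x"
    using assms(1)[OF assms(2)] by (simp add: field_simps eq_neg_iff_add_eq_0)
  then show False using Im_log_deriv_nonpos[OF assms(1,2)] assms(3) by auto
qed

text \<open>The sum below is the value at 0 of \<open>f(-d/dw) g\<close>.\<close>

lemma apolar_pairing_nonzero:
  fixes f g :: "complex poly"
  assumes "\<And>w. Im w \<ge> 0 \<Longrightarrow> poly f w \<noteq> 0" "\<And>w. Im w \<ge> 0 \<Longrightarrow> poly g w \<noteq> 0" "degree f \<le> N"
  shows "(\<Sum>m\<le>N. coeff f m * ((-1) ^ m * fact m * coeff g m)) \<noteq> 0"
  using assms
proof (induction "degree f" arbitrary: f g N)
  case 0
  then obtain a where f: "f = [:a:]" by (metis degree_eq_zeroE)
  have "(\<Sum>m\<le>N. coeff f m * ((-1) ^ m * fact m * coeff g m)) = 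
      (\<Sum>m\<in>{0}. coeff f m * ((-1) ^ m * fact m * coeff g m))"
    by (rule sum.mono_neutral_right) (auto simp: f coeff_pCons split: nat.splits)
  also have "\<dots> = poly f 0 * poly g 0" by (simp add: f poly_0_coeff_0)
  finally show ?case using "0.prems" by simp
next
  case (Suc n)
  obtain r where r: "poly f r = 0"
    using alg_closed_imp_poly_has_root[of f] Suc.hyps(2) by auto
  then obtain h where h: "f = [:-r, 1:] * h" by (auto simp: poly_eq_0_iff_dvd)
  have "h \<noteq> 0" using h Suc.hyps(2) by auto
  then have "degree f = degree [:-r, 1:] + degree h" unfolding h by (intro degree_mult_eq) auto
  then have dh: "n = degree h" using Suc.hyps(2) by simp
  have hz: "poly h w \<noteq> 0" if "Im w \<ge> 0" for w using Suc.prems(1)[OF that] by (simp add: h)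
  have "Im r < 0" using Suc.prems(1)[of r] r by force
  obtain M where M: "N = Suc M" "degree h \<le> M"
    using Suc.prems(3) Suc.hyps(2) dh by (cases N) auto
  \<comment> \<open>For f = (x - r) h one has f(-d/dw) g = -h(-d/dw)(g' + r g), which lowers the
    degree of f by one.\<close>
  define G where "G = pderiv g + smult r g"
  have G: "poly G w \<noteq> 0" if "Im w \<ge> 0" for w
    unfolding G_def using Suc.prems(2) that \<open>Im r < 0\<close> by (rule pderiv_plus_smult_nonzero)
  let ?c = "\<lambda>m. (-1) ^ m * fact m * coeff g m"
  have cf: "coeff f m = (case m of 0 \<Rightarrow> 0 | Suc j \<Rightarrow> coeff h j) - r * coeff h m" for m
    by (simp add: h coeff_pCons split: nat.split)
  have "(\<Sum>m\<le>N. coeff f m * ?c m)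
      = (\<Sum>m\<le>Suc M. (case m of 0 \<Rightarrow> 0 | Suc j \<Rightarrow> coeff h j) * ?c m) - (\<Sum>m\<le>Suc M. r * coeff h m * ?c m)"
    unfolding cf M(1) by (simp only: left_diff_distrib sum_subtractf)
  also have "(\<Sum>m\<le>Suc M. (case m of 0 \<Rightarrow> 0 | Suc j \<Rightarrow> coeff h j) * ?c m) = (\<Sum>j\<le>M. coeff h j * ?c (Suc j))"
    by (subst sum.atMost_Suc_shift) simp
  also have "(\<Sum>m\<le>Suc M. r * coeff h m * ?c m) = (\<Sum>m\<le>M. r * coeff h m * ?c m)"
    using M(2) by (simp add: coeff_eq_0)
  also have "(\<Sum>j\<le>M. coeff h j * ?c (Suc j)) - (\<Sum>m\<le>M. r * coeff h m * ?c m)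
      = - (\<Sum>m\<le>M. coeff h m * ((-1) ^ m * fact m * coeff G m))"
    unfolding sum_subtractf[symmetric] sum_negf[symmetric]
    by (intro sum.cong) (auto simp: G_def coeff_pderiv algebra_simps)
  also have "\<dots> \<noteq> 0"
    using Suc.hyps(1)[OF dh hz G M(2)] by simp
  finally show ?case .
qed

section \<open>Passage to the limit\<close>

lemma tendsto_coeff_translate:
  fixes f :: "'a::{real_normed_field} poly"
  assumes "(c \<longlongrightarrow> 0) F"
  shows "((\<lambda>k. coeff (pcompose f [:c k, 1:]) m) \<longlongrightarrow> coeff f m) F"
proof (induction f arbitrary: m)
  case (pCons a f)
  have eq: "coeff (pcompose (pCons a f) [:x, 1:]) m = coeff [:a:] m +
    (x * coeff (pcompose f [:x, 1:]) m + (case m of 0 \<Rightarrow> 0 | Suc j \<Rightarrow> coeff (pcompose f [:x, 1:]) j))" for x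
    by (simp add: pcompose_pCons coeff_pCons split: nat.split)
  have "((\<lambda>k. coeff [:a:] m + (c k * coeff (pcompose f [:c k, 1:]) m
        + (case m of 0 \<Rightarrow> 0 | Suc j \<Rightarrow> coeff (pcompose f [:c k, 1:]) j)))
      \<longlongrightarrow> coeff [:a:] m + (0 * coeff f m + (case m of 0 \<Rightarrow> 0 | Suc j \<Rightarrow> coeff f j))) F"
    by (intro tendsto_intros assms pCons.IH) (auto split: nat.split intro: pCons.IH)
  also have "coeff [:a:] m + (0 * coeff f m + (case m of 0 \<Rightarrow> 0 | Suc j \<Rightarrow> coeff f j)) = coeff (pCons a f) m"
    by (simp add: coeff_pCons split: nat.split)
  finally show ?case unfolding eq .
qed auto

lemma linear_op_0: "linear_op T \<Longrightarrow> T 0 = 0"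
  unfolding linear_op_def by (metis smult_0_left)

lemma linear_op_sum:
  assumes "linear_op T" shows "T (\<Sum>i\<in>A. smult (c i) (g i)) = (\<Sum>i\<in>A. smult (c i) (T (g i)))"
  using assms linear_op_0[OF assms]
  by (induction A rule: infinite_finite_induct) (auto simp: linear_op_def)

lemma linear_op_conv_sum:
  assumes "linear_op T" "degree f \<le> N"
  shows "T f = (\<Sum>m\<le>N. smult (coeff f m) (T (monom 1 m)))"
proof -
  have "f = (\<Sum>m\<le>N. smult (coeff f m) (monom 1 m))"
    using poly_as_sum_of_monoms'[OF assms(2)] by (simp add: smult_monom)
  then show ?thesis using linear_op_sum[OF assms(1)] by metis
qed

text \<open>Hurwitz' theorem asks for a nonconstant limit, so constants are treated apart: a
  polynomial that is 0 on the half plane has infinitely many roots and is 0.\<close>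

lemma stable1_or_0_if_locally_uniform_limit:
  fixes p :: "complex poly" and q :: "nat \<Rightarrow> complex poly"
  assumes nz: "\<And>k z. Im z > 0 \<Longrightarrow> poly (q k) z \<noteq> 0"
    and lim: "\<And>K. compact K \<Longrightarrow> K \<subseteq> {z. Im z > 0} \<Longrightarrow>
      uniform_limit K (\<lambda>k z. poly (q k) z) (poly p) sequentially"
  shows "stable1 p \<or> p = 0"
proof (cases "poly p constant_on {z. Im z > 0}")
  case True
  then obtain c where c: "\<And>z. Im z > 0 \<Longrightarrow> poly p z = c" by (auto simp: constant_on_def)
  show ?thesis
  proof (cases "c = 0")
    case True
    have "infinite {z::complex. Im z > 0}"
    proof -
      have "\<i> \<in> {z. Im z > 0}" by simp
      moreover have "open {z. Im z > 0}" by (rule open_halfspace_Im_gt)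
      ultimately show ?thesis using finite_imp_not_open by blast
    qed
    moreover have "{z. Im z > 0} \<subseteq> {z. poly p z = 0}" using c True by auto
    ultimately have "p = 0" using poly_roots_finite finite_subset by blast
    then show ?thesis ..
  next
    case False
    then have "p \<noteq> 0" using c[of "\<i>"] by auto
    then show ?thesis using c False by (auto simp: stable1_def)
  qed
next
  case False
  have "poly p z0 \<noteq> 0" if "Im z0 > 0" for z0
  proof (rule Hurwitz_no_zeros[where S = "{z. Im z > 0}" and \<F> = "\<lambda>k z. poly (q k) z" and g = "poly p"])
    show "connected {z. 0 < Im z}" by (intro convex_connected convex_halfspace_Im_gt)
  qed (use assms False that in \<open>auto intro!: open_halfspace_Im_gt holomorphic_intros\<close>)
  moreover have "p \<noteq> 0" using False by (auto simp: constant_on_def)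
  ultimately show ?thesis by (auto simp: stable1_def)
qed

lemma eval2_translate: "eval2 (pcompose q [:[:c:], 1:]) z w = eval2 q z (w + c)"
  by (simp add: eval2_conv_poly poly_pcompose add.commute)

lemma coeff_eval2_poly: "coeff (map_poly (\<lambda>c. poly c z) q) m = poly (coeff q m) z"
  by (simp add: coeff_map_poly)

lemma continuous_on_eval2: "continuous_on S (\<lambda>zw. eval2 q (fst zw) (snd zw))"
  unfolding eval2_conv_poly by (induction q) (auto intro!: continuous_intros)

text \<open>Uniform convergence compares \<open>p k\<close> with F at the shifted point; uniform
  continuity of F on a larger compact set accounts for the shift.\<close>

lemma uniform_limit_translate:
  fixes p :: "nat \<Rightarrow> complex poly poly"
  assumes lim: "\<And>K. compact K \<Longrightarrow> uniform_limit K (\<lambda>k zw. eval2 (p k) (fst zw) (snd zw)) F sequentially"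
    and K: "compact K" and c: "c \<longlonglongrightarrow> 0"
  shows "uniform_limit (K \<times> cball 0 1) (\<lambda>k zw. eval2 (p k) (fst zw) (snd zw + c k)) F sequentially"
proof (rule uniform_limitI)
  fix e :: real assume "e > 0"
  \<comment> \<open>Radius 2 leaves room for w + c k, where |w| \<le> 1 and eventually |c k| <
    1.\<close>
  define L where "L = K \<times> cball (0::complex) 2"
  have L: "compact L" unfolding L_def by (intro compact_Times K compact_cball)
  have "continuous_on L F"
    by (rule uniform_limit_theorem[OF _ lim[OF L]]) (auto intro: continuous_on_eval2 always_eventually)
  then have "uniformly_continuous_on L F" using L by (rule compact_uniformly_continuous)
  then obtain d where d: "d > 0" "\<And>x y. x \<in> L \<Longrightarrow> y \<in> L \<Longrightarrow> dist y x < d \<Longrightarrow> dist (F y) (F x) < e / 2"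
    unfolding uniformly_continuous_on_def using \<open>e > 0\<close> by (metis half_gt_zero)
  have "\<forall>\<^sub>F k in sequentially. dist (c k) 0 < min d 1"
    by (rule tendstoD[OF c]) (use d(1) in simp)
  moreover have "\<forall>\<^sub>F k in sequentially. \<forall>x\<in>L. dist (eval2 (p k) (fst x) (snd x)) (F x) < e / 2"
    using uniform_limitD[OF lim[OF L], of "e / 2"] \<open>e > 0\<close> by simp
  ultimately show "\<forall>\<^sub>F k in sequentially. \<forall>x\<in>K \<times> cball 0 1. dist (eval2 (p k) (fst x) (snd x + c k)) (F x) < e"
  proof eventually_elim
    case (elim k)
    show ?case
    proof
      fix x assume x: "x \<in> K \<times> cball (0::complex) 1"
      then obtain z w where zw: "x = (z, w)" "z \<in> K" "norm w \<le> 1" by auto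
      have 1: "x \<in> L" using zw by (auto simp: L_def)
      have 2: "(z, w + c k) \<in> L"
        using zw elim norm_triangle_ineq[of w "c k"] by (auto simp: L_def)
      have "dist (z, w + c k) x < d" using elim zw by (simp add: dist_Pair_Pair dist_norm)
      from d(2)[OF 1 2 this] have "dist (F (z, w + c k)) (F x) < e / 2" .
      moreover have "dist (eval2 (p k) z (w + c k)) (F (z, w + c k)) < e / 2"
        using elim(2) 2 by force
      ultimately show "dist (eval2 (p k) (fst x) (snd x + c k)) (F x) < e"
        using zw(1) dist_triangle_half_r[of "F (z, w + c k)"] by (metis dist_commute fst_conv snd_conv)
    qed
  qed
qed

lemma eval2_sums: "(\<lambda>m. poly (coeff q m) z * w ^ m) sums eval2 q z w"
proof -
  let ?q = "map_poly (\<lambda>c. poly c z) q"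
  have "(\<lambda>m. coeff ?q m * w ^ m) sums (\<Sum>m\<le>degree ?q. coeff ?q m * w ^ m)"
    by (rule sums_finite) (auto simp: coeff_eq_0)
  then show ?thesis unfolding eval2_def poly_altdef[of ?q] coeff_eval2_poly .
qed

text \<open>Cauchy's inequality on the unit circle in w, applied to the difference from the limit
  with a bound that does not depend on z.\<close>

lemma uniform_limit_coeff:
  fixes q :: "nat \<Rightarrow> complex poly poly" and c :: "nat \<Rightarrow> complex \<Rightarrow> complex"
  assumes lim: "uniform_limit (K \<times> cball 0 1) (\<lambda>k zw. eval2 (q k) (fst zw) (snd zw)) F sequentially"
    and sums: "\<And>z w. (\<lambda>m. c m z * w ^ m) sums F (z, w)"
  shows "uniform_limit K (\<lambda>k z. poly (coeff (q k) m) z) (c m) sequentially"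
proof (rule uniform_limitI)
  fix e :: real assume "e > 0"
  with lim have "\<forall>\<^sub>F k in sequentially. \<forall>x\<in>K \<times> cball 0 1. dist (eval2 (q k) (fst x) (snd x)) (F x) < e / 2"
    by (intro uniform_limitD) auto
  then show "\<forall>\<^sub>F k in sequentially. \<forall>z\<in>K. dist (poly (coeff (q k) m) z) (c m z) < e"
  proof eventually_elim
    case (elim k)
    show ?case
    proof
      fix z assume z: "z \<in> K"
      have "norm (poly (coeff (q k) m) z - c m z) * 1 ^ m \<le> e / 2"
      proof (rule norm_powser_coeff_le)
        show "(\<lambda>m. (poly (coeff (q k) m) z - c m z) * w ^ m) sums (eval2 (q k) z w - F (z, w))" for w
          using sums_diff[OF eval2_sums sums] by (simp add: algebra_simps)
        show "norm (eval2 (q k) z w - F (z, w)) \<le> e / 2" if "norm w = 1" for w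
          using bspec[OF elim, of "(z, w)"] z that by (simp add: dist_norm)
      qed simp
      then show "dist (poly (coeff (q k) m) z) (c m z) < e" using \<open>e > 0\<close> by (simp add: dist_norm)
    qed
  qed
qed

lemma uniform_limit_sum:
  fixes f :: "'i \<Rightarrow> 'a \<Rightarrow> 'b \<Rightarrow> 'c::real_normed_vector"
  assumes "\<And>i. i \<in> I \<Longrightarrow> uniform_limit S (f i) (l i) F"
  shows "uniform_limit S (\<lambda>n x. \<Sum>i\<in>I. f i n x) (\<lambda>x. \<Sum>i\<in>I. l i x) F"
  using assms by (induction I rule: infinite_finite_induct) (auto intro!: uniform_limit_intros)

text \<open>The pairing is nonzero for polynomials without zeros in the closed half plane. Hence
  \<open>f\<close> and \<open>p k\<close> are both translated by a point \<open>c k\<close> of the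
  open half plane tending to 0 before Hurwitz' theorem is applied in z.\<close>

lemma GT_in_closure_imp_stable:
  assumes T: "linear_op T" and GT: "GT_in_closure T" and f: "stable1 f"
  shows "stable1 (T f) \<or> T f = 0"
proof -
  obtain F p where p: "\<And>k. stable2 (p k)"
    and lim: "\<And>K. compact K \<Longrightarrow> uniform_limit K (\<lambda>k zw. eval2 (p k) (fst zw) (snd zw)) F sequentially"
    and sums: "\<And>z w. GT_term T z w sums F (z, w)"
    using GT unfolding GT_in_closure_def stable2_closure_def by blast
  \<comment> \<open>\<open>Suc k\<close> keeps the imaginary part positive at k = 0 as well, where
    division by zero would yield 0.\<close>
  define c where "c k = \<i> / of_nat (Suc k)" for k
  have c0: "c \<longlonglongrightarrow> 0" unfolding c_def
    by (rule LIMSEQ_Suc[of "\<lambda>k. \<i> / of_nat k"]) (rule lim_const_over_n)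
  have Imc: "Im (c k) > 0" for k by (simp add: c_def Im_divide)
  define N where "N = degree f"
  define fk where "fk k = pcompose f [:c k, 1:]" for k
  define gk where "gk k = pcompose (p k) [:[:c k:], 1:]" for k
  define a where "a m z = ((-1) ^ m / fact m) * poly (T (monom 1 m)) z" for m z
  have sums': "(\<lambda>m. a m z * w ^ m) sums F (z, w)" for z w
    using sums[of z w] by (simp add: a_def GT_term_def[abs_def])
  \<comment> \<open>This is f_k(-d/dw) g_k at w = 0 as a polynomial in z; the factorial turns a
    coefficient into a derivative at 0.\<close>
  define q where "q k = (\<Sum>m\<le>N. smult (coeff (fk k) m * ((-1) ^ m * fact m)) (coeff (gk k) m))" for k
  have pq: "poly (q k) z = (\<Sum>m\<le>N. coeff (fk k) m * ((-1) ^ m * fact m * poly (coeff (gk k) m) z))" for k z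
    by (simp add: q_def poly_sum mult.assoc)
  show ?thesis
  proof (rule stable1_or_0_if_locally_uniform_limit)
    fix k and z :: complex assume z: "Im z > 0"
    show "poly (q k) z \<noteq> 0"
      unfolding pq coeff_eval2_poly[symmetric]
    proof (rule apolar_pairing_nonzero)
      show "poly (fk k) w \<noteq> 0" if "Im w \<ge> 0" for w
        using f that Imc[of k] by (auto simp: fk_def poly_pcompose stable1_def)
      show "poly (map_poly (\<lambda>c. poly c z) (gk k)) w \<noteq> 0" if "Im w \<ge> 0" for w
        using p[of k] that Imc[of k] z unfolding eval2_def[symmetric] gk_def eval2_translate
        by (auto simp: stable2_def)
      show "degree (fk k) \<le> N" by (simp add: fk_def N_def degree_pcompose)
    qed
  next
    fix K :: "complex set" assume K: "compact K"
    have "uniform_limit K (\<lambda>k z. poly (coeff (gk k) m) z) (a m) sequentially" for m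
      using uniform_limit_translate[OF lim K c0] sums'
      by (intro uniform_limit_coeff) (simp_all add: gk_def eval2_translate)
    moreover have "bounded (a m ` K)" for m
      unfolding a_def by (intro compact_imp_bounded compact_continuous_image K continuous_intros)
    moreover have "bounded ((\<lambda>z. (-1) ^ m * fact m * a m z) ` K)" for m
      unfolding a_def by (intro compact_imp_bounded compact_continuous_image K continuous_intros)
    moreover have "uniform_limit K (\<lambda>k z. coeff (fk k) m) (\<lambda>z. coeff f m) sequentially" for m
      using tendsto_coeff_translate[OF c0, of f m] unfolding fk_def
      by (intro uniform_limitI) (auto simp: tendsto_iff)
    ultimately have "uniform_limit K (\<lambda>k z. \<Sum>m\<le>N. coeff (fk k) m * ((-1) ^ m * fact m * poly (coeff (gk k) m) z))
      (\<lambda>z. \<Sum>m\<le>N. coeff f m * ((-1) ^ m * fact m * a m z)) sequentially"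
      by (intro uniform_limit_sum uniform_lim_mult uniform_limit_const)
        (auto simp: image_constant_conv intro: finite_imp_bounded)
    moreover have "(\<Sum>m\<le>N. coeff f m * ((-1) ^ m * fact m * a m z)) = poly (T f) z" for z
      unfolding linear_op_conv_sum[OF T, of f N, unfolded N_def, OF order_refl] N_def a_def
      by (simp add: poly_sum mult.assoc flip: power_mult_distrib)
    ultimately show "uniform_limit K (\<lambda>k z. poly (q k) z) (poly (T f)) sequentially"
      unfolding pq by simp
  qed
qed

section \<open>Convergence of stable Jensen polynomials\<close>

text \<open>This is n(n-1)...(n-k+1)/n^k, the factor by which the coefficient of w^k in (1 - xw/n)^n
  differs from that in exp(-xw).\<close>

definition falling_ratio :: "nat \<Rightarrow> nat \<Rightarrow> real" where
  "falling_ratio n k = real (n choose k) * fact k / real n ^ k"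

lemma falling_ratio_0 [simp]: "falling_ratio n 0 = 1"
  by (simp add: falling_ratio_def)

lemma falling_ratio_Suc:
  "falling_ratio n (Suc k) = falling_ratio n k * ((real n - real k) / real n)"
proof -
  have "Suc k * (n choose Suc k) = (n - k) * (n choose k)"
    by (metis binomial_absorb_comp binomial_absorption mult.commute)
  then have "real (Suc k) * real (n choose Suc k) = real (n - k) * real (n choose k)"
    by (metis of_nat_mult)
  \<comment> \<open>For k > n truncated and real subtraction differ, but the binomial coefficient is
    then 0.\<close>
  also have "\<dots> = (real n - real k) * real (n choose k)"
    by (cases "k \<le> n") (auto simp: of_nat_diff)
  finally have eq: "real (Suc k) * real (n choose Suc k) = (real n - real k) * real (n choose k)" .
  have "real (n choose Suc k) * fact (Suc k) = (real (Suc k) * real (n choose Suc k)) * fact k"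
    by (simp add: algebra_simps)
  then show ?thesis unfolding falling_ratio_def eq by (simp add: ac_simps del: fact_Suc)
qed

lemma falling_ratio_nonneg: "falling_ratio n k \<ge> 0"
  by (simp add: falling_ratio_def)

lemma falling_ratio_eq_0: "k > n \<Longrightarrow> falling_ratio n k = 0"
  by (simp add: falling_ratio_def)

lemma falling_ratio_pos: "k \<le> n \<Longrightarrow> falling_ratio n k > 0"
  by (cases "n = 0") (auto simp: falling_ratio_def)

lemma falling_ratio_Suc_le: "falling_ratio n (Suc k) \<le> falling_ratio n k"
proof (cases "k \<le> n")
  case True
  then have "(real n - real k) / real n \<le> 1" by (simp add: divide_le_eq)
  then show ?thesis unfolding falling_ratio_Suc
    by (metis mult.right_neutral mult_left_mono falling_ratio_nonneg)
qed (simp add: falling_ratio_eq_0)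

lemma falling_ratio_le_1: "falling_ratio n k \<le> 1"
proof (induction k)
  case (Suc k)
  then show ?case using falling_ratio_Suc_le[of n k] by simp
qed simp

lemma tendsto_falling_ratio: "(\<lambda>n. falling_ratio n k) \<longlonglongrightarrow> 1"
proof (induction k)
  case (Suc k)
  have "(\<lambda>n. (real n - real k) / real n) \<longlonglongrightarrow> 1" by real_asymp
  from tendsto_mult[OF Suc this] show ?case unfolding falling_ratio_Suc by simp
qed simp

text \<open>Writing c_k = a_k/k!, these are the classical Jensen polynomials, the sums of binom(n,k)
  a_k w^k, taken at w/n.\<close>

definition jensen_poly :: "(nat \<Rightarrow> complex poly) \<Rightarrow> nat \<Rightarrow> complex poly poly" where
  "jensen_poly c n = (\<Sum>k\<le>n. monom (smult (of_real (falling_ratio n k)) (c k)) k)"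

lemma coeff_jensen_poly: "coeff (jensen_poly c n) k = smult (of_real (falling_ratio n k)) (c k)"
  by (cases "k \<le> n") (auto simp: jensen_poly_def coeff_sum falling_ratio_eq_0)

text \<open>Pairs are used to fit \<open>stable2_closure\<close>. The sum is meaningful only where
  the series converges, so summability is proved separately.\<close>

abbreviation w_series :: "(nat \<Rightarrow> complex poly) \<Rightarrow> complex \<times> complex \<Rightarrow> complex" where
  "w_series c zw \<equiv> (\<Sum>k. poly (c k) (fst zw) * snd zw ^ k)"

section \<open>From uniform bounds to convergence\<close>

context
  fixes c :: "nat \<Rightarrow> complex poly" and K :: "complex set" and r M :: real and N :: nat
  assumes r: "r > 0"
    and bd: "\<And>n z w. n \<ge> N \<Longrightarrow> z \<in> K \<Longrightarrow> norm w \<le> 2 * r \<Longrightarrow> norm (eval2 (jensen_poly c n) z w) \<le> M"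
begin

text \<open>Cauchy's inequality holds for every Jensen polynomial, and for fixed k the damping
  factor tends to 1.\<close>

lemma coeff_bound_if_jensen_bounded:
  assumes "z \<in> K"
  shows "norm (poly (c k) z) * (2 * r) ^ k \<le> M"
proof (rule tendsto_upperbound)
  show "(\<lambda>n. falling_ratio n k * (norm (poly (c k) z) * (2 * r) ^ k)) \<longlonglongrightarrow> norm (poly (c k) z) * (2 * r) ^ k"
    using tendsto_mult_right[OF tendsto_falling_ratio] by simp
  show "\<forall>\<^sub>F n in sequentially. falling_ratio n k * (norm (poly (c k) z) * (2 * r) ^ k) \<le> M"
    using eventually_ge_at_top[of N]
  proof eventually_elim
    case (elim n)
    have "norm (poly (coeff (jensen_poly c n) k) z) * (2 * r) ^ k \<le> M"
      using r bd[OF elim assms] by (intro norm_powser_coeff_le[OF eval2_sums]) auto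
    then show ?case using falling_ratio_nonneg[of n k]
      by (simp add: coeff_jensen_poly norm_mult mult.assoc)
  qed
qed simp

text \<open>Passing from radius 2r to r turns the coefficient bound into geometric decay.\<close>

lemma w_series_term_le:
  assumes "z \<in> K" "norm w \<le> r"
  shows "norm (poly (c k) z * w ^ k) \<le> M * (1 / 2) ^ k"
proof -
  have "norm (poly (c k) z * w ^ k) \<le> norm (poly (c k) z) * r ^ k"
    using assms(2) by (auto simp: norm_mult norm_power intro!: mult_left_mono power_mono)
  also have "\<dots> = norm (poly (c k) z) * (2 * r) ^ k * (1 / 2) ^ k"
    by (simp add: power_mult_distrib field_simps)
  also have "\<dots> \<le> M * (1 / 2) ^ k"
    by (intro mult_right_mono coeff_bound_if_jensen_bounded assms) auto
  finally show ?thesis .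
qed

lemma summable_w_series:
  assumes "z \<in> K" "norm w \<le> r"
  shows "summable (\<lambda>k. poly (c k) z * w ^ k)"
proof (rule summable_comparison_test'[OF _ w_series_term_le[OF assms]])
  show "summable (\<lambda>k. M * (1 / 2) ^ k)" by (intro summable_mult summable_geometric) auto
qed

text \<open>The error is dominated, uniformly in z and w, by a series whose terms carry the factor 1
  - \<open>falling_ratio n k\<close>. Each term tends to 0 and the geometric majorant lets Tannery's
  theorem sum them.\<close>

lemma uniform_limit_jensen_poly:
  "uniform_limit (K \<times> cball 0 r) (\<lambda>n zw. eval2 (jensen_poly c n) (fst zw) (snd zw)) (w_series c) sequentially"
proof -
  define a where "a k n = (1 - falling_ratio n k) * (M * (1 / 2) ^ k)" for k n
  \<comment> \<open>The absolute value covers an empty \<open>K\<close>, for which \<open>M\<close>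
    may be negative.\<close>
  have geo: "summable (\<lambda>k. \<bar>M\<bar> * (1 / 2) ^ k)" by (intro summable_mult summable_geometric) auto
  have a_le: "norm (a k n) \<le> \<bar>M\<bar> * (1 / 2) ^ k" for k n
    using mult_right_mono[of "1 - falling_ratio n k" 1 "\<bar>M\<bar> * (1 / 2) ^ k"]
      falling_ratio_nonneg[of n k] falling_ratio_le_1[of n k]
    by (simp add: a_def abs_mult)
  have "(\<lambda>n. a k n) \<longlonglongrightarrow> (1 - 1) * (M * (1 / 2) ^ k)" for k
    unfolding a_def by (intro tendsto_intros tendsto_falling_ratio)
  then have lim0: "(\<lambda>n. \<Sum>k. a k n) \<longlonglongrightarrow> (\<Sum>k. 0)"
    using tannerys_theorem[of a "\<lambda>_. 0" sequentially "\<lambda>k. \<bar>M\<bar> * (1 / 2) ^ k"] geo a_le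
    by (auto intro: always_eventually)
  have sa: "summable (\<lambda>k. a k n)" for n
    by (rule summable_comparison_test'[OF geo a_le])
  have "norm (eval2 (jensen_poly c n) z w - w_series c (z, w)) \<le> (\<Sum>k. a k n)"
    if "z \<in> K" "norm w \<le> r" for n z w
  proof -
    have "(\<lambda>k. poly (coeff (jensen_poly c n) k) z * w ^ k - poly (c k) z * w ^ k) sums
       (eval2 (jensen_poly c n) z w - w_series c (z, w))"
      using summable_sums[OF summable_w_series[OF that]] by (intro sums_diff eval2_sums) simp
    then have "eval2 (jensen_poly c n) z w - w_series c (z, w) =
        (\<Sum>k. poly (coeff (jensen_poly c n) k) z * w ^ k - poly (c k) z * w ^ k)"
      by (simp add: sums_iff)
    also have "norm \<dots> \<le> (\<Sum>k. a k n)"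
    proof (rule norm_suminf_le[OF _ sa])
      fix k
      have "poly (coeff (jensen_poly c n) k) z * w ^ k - poly (c k) z * w ^ k =
        - (of_real (1 - falling_ratio n k) * (poly (c k) z * w ^ k))"
        by (simp add: coeff_jensen_poly algebra_simps)
      also have "norm \<dots> = (1 - falling_ratio n k) * norm (poly (c k) z * w ^ k)"
        using falling_ratio_le_1[of n k] by (simp only: norm_minus_cancel norm_mult norm_of_real)
      also have "\<dots> \<le> a k n" unfolding a_def
        using falling_ratio_le_1[of n k] by (intro mult_left_mono w_series_term_le that) auto
      finally show "norm (poly (coeff (jensen_poly c n) k) z * w ^ k - poly (c k) z * w ^ k) \<le> a k n" .
    qed
    finally show ?thesis .
  qed
  note le = this
  show ?thesis
  proof (rule uniform_limitI)
    fix e :: real assume "e > 0"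
    then have "\<forall>\<^sub>F n in sequentially. dist (\<Sum>k. a k n) 0 < e"
      using tendstoD[OF lim0] by simp
    then show "\<forall>\<^sub>F n in sequentially. \<forall>zw\<in>K \<times> cball 0 r.
        dist (eval2 (jensen_poly c n) (fst zw) (snd zw)) (w_series c zw) < e"
    proof eventually_elim
      case (elim n)
      show ?case
      proof
        fix zw assume "zw \<in> K \<times> cball (0::complex) r"
        then show "dist (eval2 (jensen_poly c n) (fst zw) (snd zw)) (w_series c zw) < e"
          using le[of "fst zw" "snd zw" n] elim by (auto simp: dist_norm mem_Times_iff)
      qed
    qed
  qed
qed

end

lemma w_series_holomorphic:
  assumes "\<And>w. summable (\<lambda>k. poly (c k) z * w ^ k)"
  shows "(\<lambda>w. w_series c (z, w)) holomorphic_on A"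
proof -
  have "\<exists>f'. ((\<lambda>w. w_series c (z, w)) has_field_derivative f') (at w)" for w
  proof -
    have "(\<lambda>w. w_series c (z, w)) holomorphic_on ball 0 (norm w + 1)"
      using summable_sums[OF assms] by (intro power_series_holomorphic[where a = "\<lambda>k. poly (c k) z"]) auto
    then show ?thesis
      using holomorphic_on_imp_differentiable_at[of _ "ball 0 (norm w + 1)" w]
      by (auto simp: field_differentiable_def)
  qed
  then show ?thesis
    by (auto simp: holomorphic_on_def field_differentiable_def intro: has_field_derivative_at_within)
qed

section \<open>Bounds along diagonal lines\<close>

lemma norm_coeff_poly_le:
  fixes q :: "complex poly"
  assumes "\<And>t. norm t = 1 \<Longrightarrow> norm (poly q t) \<le> M"
  shows "norm (coeff q k) \<le> M"
proof -
  have "(\<lambda>k. coeff q k * t ^ k) sums poly q t" for t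
    unfolding poly_altdef by (rule sums_finite) (auto simp: coeff_eq_0)
  from norm_powser_coeff_le[OF this, of 1 M k] assms show ?thesis by simp
qed

text \<open>Both variables move by the same t, so Im t > 0 raises both imaginary parts: from a base
  point in the product of upper half planes, stability passes to the restriction.\<close>

lemma eval2_diagonal: "\<exists>q. \<forall>t. poly q t = eval2 p (z0 + t) (w0 + t)"
proof (induction p)
  case (pCons a p)
  then obtain q where "\<And>t. poly q t = eval2 p (z0 + t) (w0 + t)" by blast
  then show ?case
    by (intro exI[of _ "pcompose a [:z0, 1:] + [:w0, 1:] * q"])
      (auto simp: poly_pcompose eval2_conv_poly algebra_simps)
qed (auto intro: exI[of _ 0] simp: eval2_conv_poly)

text \<open>Any point of \<open>\<complex>\<^sup>2\<close> lies on the diagonal line through a point of the product of upper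
  half planes, so a bound for a stable polynomial near the latter propagates.\<close>

lemma stable2_diagonal_bound:
  assumes p: "stable2 p"
    and R: "Im z + R > 0" "Im w + R > 0"
    and low: "norm (eval2 p (z + \<i> * R) (w + \<i> * R)) \<ge> \<delta>" and "\<delta> > 0" and "R \<ge> 0"
    and up: "\<And>t. norm t \<le> 1 \<Longrightarrow> norm (eval2 p (z + \<i> * R + t) (w + \<i> * R + t)) \<le> M"
  shows "norm (eval2 p z w) \<le> M * exp (M / \<delta> * R + (3 * (M / \<delta>)\<^sup>2 + 2 * (M / \<delta>)) / 2 * R\<^sup>2)"
proof -
  obtain q where q: "\<And>t. poly q t = eval2 p (z + \<i> * R + t) (w + \<i> * R + t)"
    using eval2_diagonal by blast
  have c0: "coeff q 0 = eval2 p (z + \<i> * R) (w + \<i> * R)"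
    using q[of 0] by (simp add: poly_0_coeff_0)
  have M: "norm (coeff q k) \<le> M" for k
    using up by (intro norm_coeff_poly_le) (simp add: q)
  then have "M \<ge> 0" using norm_ge_zero order_trans by blast
  \<comment> \<open>The lower bound \<delta> on the constant coefficient turns the absolute bound M
    into the relative bounds of Szasz' inequality.\<close>
  have B: "norm (coeff q k) \<le> M / \<delta> * norm (coeff q 0)" for k
  proof -
    have "M / \<delta> * \<delta> \<le> M / \<delta> * norm (coeff q 0)"
      using low \<open>\<delta> > 0\<close> \<open>M \<ge> 0\<close> unfolding c0 by (intro mult_left_mono) auto
    then show ?thesis using M[of k] \<open>\<delta> > 0\<close> by simp
  qed
  \<comment> \<open>The parameter t = -iR leads back to the point (z, w).\<close>
  have "norm (poly q (- \<i> * R)) \<le> norm (coeff q 0) *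
      exp (M / \<delta> * norm (- \<i> * R) + (3 * (M / \<delta>)\<^sup>2 + 2 * (M / \<delta>)) / 2 * (norm (- \<i> * R))\<^sup>2)"
  proof (rule Szasz_inequality_0[OF _ _ B B])
    show "poly q t \<noteq> 0" if "Im t > 0" for t
      using p that R by (auto simp: q stable2_def)
    show "coeff q 0 \<noteq> 0" using low \<open>\<delta> > 0\<close> by (auto simp: c0)
  qed
  also have "\<dots> \<le> M * exp (M / \<delta> * R + (3 * (M / \<delta>)\<^sup>2 + 2 * (M / \<delta>)) / 2 * R\<^sup>2)"
    using M[of 0] \<open>R \<ge> 0\<close> \<open>M \<ge> 0\<close> by (intro mult_mono) (auto simp: norm_mult)
  finally show ?thesis by (simp add: q)
qed

section \<open>Uniform bounds for stable Jensen polynomials\<close>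

context
  fixes c :: "nat \<Rightarrow> complex poly" and N m :: nat
  assumes stab: "\<And>n. n \<ge> N \<Longrightarrow> stable2 (jensen_poly c n)"
    and low: "\<And>k. k < m \<Longrightarrow> c k = 0"
    and cm: "stable1 (c m)"
begin

text \<open>Szasz' inequality in w, starting at w^m. As \<open>c m\<close> has no zero on
  \<open>K\<close>, the quotients of the next two coefficients by it are bounded there; damping is
  nonincreasing in k, so the same bounds hold for all n. The condition n \<ge> m keeps the leading
  low coefficient nonzero.\<close>

lemma jensen_bounded_half_plane:
  assumes K: "compact K" "K \<subseteq> {z. Im z > 0}" and "R \<ge> 0"
  shows "\<exists>M. \<forall>n\<ge>max N m. \<forall>z\<in>K. \<forall>w. norm w \<le> R \<longrightarrow> norm (eval2 (jensen_poly c n) z w) \<le> M"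
proof -
  have nz: "poly (c m) z \<noteq> 0" if "z \<in> K" for z using cm K that by (auto simp: stable1_def)
  have "\<exists>B\<ge>0. \<forall>z\<in>K. norm (poly (c (m + j)) z) \<le> B * norm (poly (c m) z)" for j
  proof -
    have "bounded ((\<lambda>z. poly (c (m + j)) z / poly (c m) z) ` K)"
      using nz by (intro compact_imp_bounded compact_continuous_image K continuous_intros) auto
    then obtain B where B: "B > 0" "\<And>z. z \<in> K \<Longrightarrow> norm (poly (c (m + j)) z / poly (c m) z) \<le> B"
      by (auto simp: bounded_pos)
    then show ?thesis using nz
      by (intro exI[of _ B]) (auto simp: norm_divide divide_le_eq)
  qed
  then obtain B1 B2 where B1: "B1 \<ge> 0" "\<And>z. z \<in> K \<Longrightarrow> norm (poly (c (m + 1)) z) \<le> B1 * norm (poly (c m) z)"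
    and B2: "B2 \<ge> 0" "\<And>z. z \<in> K \<Longrightarrow> norm (poly (c (m + 2)) z) \<le> B2 * norm (poly (c m) z)"
    by meson
  have "bounded (poly (c m) ` K)"
    by (intro compact_imp_bounded compact_continuous_image K continuous_intros)
  then obtain C where C: "C > 0" "\<And>z. z \<in> K \<Longrightarrow> norm (poly (c m) z) \<le> C"
    by (auto simp: bounded_pos)
  let ?M = "R ^ m * C * exp (B1 * R + (3 * B1\<^sup>2 + 2 * B2) / 2 * R\<^sup>2)"
  have "norm (eval2 (jensen_poly c n) z w) \<le> ?M" if n: "n \<ge> max N m" and z: "z \<in> K" and w: "norm w \<le> R" for n z w
  proof -
    define p where "p = map_poly (\<lambda>c. poly c z) (jensen_poly c n)"
    have cp: "coeff p k = of_real (falling_ratio n k) * poly (c k) z" for k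
      by (simp add: p_def coeff_eval2_poly coeff_jensen_poly)
    have nc: "norm (coeff p k) = falling_ratio n k * norm (poly (c k) z)" for k
      using falling_ratio_nonneg[of n k] by (simp add: cp norm_mult)
    have step: "norm (coeff p (m + j)) \<le> B * norm (coeff p m)"
      if "norm (poly (c (m + j)) z) \<le> B * norm (poly (c m) z)" "falling_ratio n (m + j) \<le> falling_ratio n m" for j B
    proof -
      have "norm (coeff p (m + j)) \<le> falling_ratio n m * (B * norm (poly (c m) z))"
        unfolding nc using that falling_ratio_nonneg by (intro mult_mono) auto
      then show ?thesis by (simp add: nc mult_ac)
    qed
    have "norm (poly p w) \<le> norm w ^ m * norm (coeff p m) *
        exp (B1 * norm w + (3 * B1\<^sup>2 + 2 * B2) / 2 * (norm w)\<^sup>2)"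
    proof (rule Szasz_inequality)
      show "poly p w \<noteq> 0" if "Im w > 0" for w
        using stab[of n] n K z that unfolding p_def eval2_def[symmetric] by (auto simp: stable2_def)
      show "coeff p k = 0" if "k < m" for k using low[OF that] by (simp add: cp)
      show "coeff p m \<noteq> 0" using nz[OF z] falling_ratio_pos[of m n] n by (simp add: cp)
      show "norm (coeff p (m + 1)) \<le> B1 * norm (coeff p m)"
        using B1(2)[OF z] falling_ratio_Suc_le[of n m] by (intro step) auto
      show "norm (coeff p (m + 2)) \<le> B2 * norm (coeff p m)"
        using B2(2)[OF z] falling_ratio_Suc_le[of n m] falling_ratio_Suc_le[of n "m + 1"] by (intro step) auto
    qed
    also have "\<dots> \<le> ?M"
    proof -
      have "norm (coeff p m) \<le> 1 * C" unfolding nc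
        using falling_ratio_le_1 C(2)[OF z] by (intro mult_mono) auto
      then show ?thesis using w B1(1) B2(1) C(1) \<open>R \<ge> 0\<close>
        by (intro mult_mono power_mono) (auto intro!: add_mono mult_left_mono power_mono)
    qed
    finally show ?thesis by (simp add: p_def eval2_def)
  qed
  then show ?thesis by blast
qed

lemma jensen_converges_half_plane:
  assumes K: "compact K" "K \<subseteq> {z. Im z > 0}"
  shows "z \<in> K \<Longrightarrow> summable (\<lambda>k. poly (c k) z * w ^ k)"
    and "R > 0 \<Longrightarrow> uniform_limit (K \<times> cball 0 R) (\<lambda>n zw. eval2 (jensen_poly c n) (fst zw) (snd zw)) (w_series c) sequentially"
proof -
  have ex: "\<exists>M. \<forall>n z w. n \<ge> max N m \<longrightarrow> z \<in> K \<longrightarrow> norm w \<le> 2 * R \<longrightarrow> norm (eval2 (jensen_poly c n) z w) \<le> M"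
    if "R > 0" for R
  proof -
    from that have "2 * R \<ge> 0" by simp
    from jensen_bounded_half_plane[OF K this] show ?thesis by blast
  qed
  show "uniform_limit (K \<times> cball 0 R) (\<lambda>n zw. eval2 (jensen_poly c n) (fst zw) (snd zw)) (w_series c) sequentially"
    if R: "R > 0" for R
  proof -
    obtain M where M: "\<forall>n z w. n \<ge> max N m \<longrightarrow> z \<in> K \<longrightarrow> norm w \<le> 2 * R \<longrightarrow> norm (eval2 (jensen_poly c n) z w) \<le> M"
      using ex[OF R] by blast
    show ?thesis by (rule uniform_limit_jensen_poly[OF R M[rule_format]])
  qed
  show "summable (\<lambda>k. poly (c k) z * w ^ k)" if z: "z \<in> K"
  proof -
    have R: "norm w + 1 > 0" by (simp add: add_nonneg_pos)
    obtain M where M: "\<forall>n z v. n \<ge> max N m \<longrightarrow> z \<in> K \<longrightarrow> norm v \<le> 2 * (norm w + 1) \<longrightarrow> norm (eval2 (jensen_poly c n) z v) \<le> M"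
      using ex[OF R] by blast
    show ?thesis by (rule summable_w_series[where N = "max N m", OF R M[rule_format] z]) simp_all
  qed
qed

text \<open>Hurwitz' theorem in w for fixed z. If the limit is constant and vanishes somewhere, it
  is identically 0 by analytic continuation, against \<open>poly (c m) z\<close> being
  nonzero.\<close>

lemma w_series_nonzero:
  assumes z: "Im z > 0" and w: "Im w > 0"
  shows "w_series c (z, w) \<noteq> 0"
proof -
  let ?G = "\<lambda>w. w_series c (z, w)"
  have K: "compact {z}" "{z} \<subseteq> {z. Im z > 0}" using z by auto
  have summ: "summable (\<lambda>k. poly (c k) z * w ^ k)" for w
    by (rule jensen_converges_half_plane(1)[OF K]) simp
  have hol: "?G holomorphic_on A" for A by (rule w_series_holomorphic[OF summ])
  show ?thesis
  proof (cases "?G constant_on {w. Im w > 0}")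
    case True
    show ?thesis
    proof
      assume G0: "w_series c (z, w) = 0"
      have 0: "?G v = 0" if "Im v > 0" for v
        using True G0 w that unfolding constant_on_def by (metis (mono_tags) mem_Collect_eq)
      have "?G v = 0" for v
      proof (rule analytic_continuation[of ?G UNIV "{w. Im w > 0}" w])
        show "w islimpt {w. Im w > 0}"
          by (rule interior_limit_point) (simp add: interior_open open_halfspace_Im_gt w)
      qed (use hol 0 in auto)
      \<comment> \<open>Cauchy's inequality with bound 0 annihilates the coefficient of w^m.\<close>
      then have "norm (poly (c m) z) * 1 ^ m \<le> 0"
        using summable_sums[OF summ] by (intro norm_powser_coeff_le[where f = ?G]) auto
      then show False using cm z by (simp add: stable1_def)
    qed
  next
    case False
    show ?thesis
    \<comment> \<open>The index is shifted by \<open>N\<close> because stability is assumed only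
      from \<open>N\<close> on.\<close>
    proof (rule Hurwitz_no_zeros[where S = "{w. Im w > 0}" and g = ?G
          and \<F> = "\<lambda>n w. eval2 (jensen_poly c (n + N)) z w"])
      show "connected {w. 0 < Im w}" by (intro convex_connected convex_halfspace_Im_gt)
      show "(\<lambda>w. eval2 (jensen_poly c (n + N)) z w) holomorphic_on {w. 0 < Im w}" for n
        unfolding eval2_def by (intro holomorphic_intros)
      fix L :: "complex set" assume "compact L"
      then obtain R where R: "R > 0" "L \<subseteq> cball 0 R"
        using bounded_subset_ballD[OF compact_imp_bounded[of L], of 0] ball_subset_cball by blast
      have "uniform_limit ({z} \<times> cball 0 R) (\<lambda>n zw. eval2 (jensen_poly c n) (fst zw) (snd zw)) (w_series c) sequentially"
        by (rule jensen_converges_half_plane(2)[OF K R(1)])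
      then have "uniform_limit L (\<lambda>n w. eval2 (jensen_poly c n) z w) ?G sequentially"
        unfolding uniform_limit_iff using R(2) by (force elim!: eventually_mono)
      then show "uniform_limit L (\<lambda>n w. eval2 (jensen_poly c (n + N)) z w) ?G sequentially"
        by (auto simp: uniform_limit_iff intro: eventually_sequentially_seg[THEN iffD2])
    next
      show "eval2 (jensen_poly c (n + N)) z w \<noteq> 0" if "w \<in> {w. 0 < Im w}" for n w
        using stab[of "n + N"] z that by (auto simp: stable2_def)
    qed (use hol False w in \<open>auto simp: open_halfspace_Im_gt\<close>)
  qed
qed

text \<open>A translation by iR moves the bidisc into a compact part of the product of upper half
  planes. There the limit is nonzero, so for large n the polynomials are bounded above and away from
  0, and the diagonal bound carries this back.\<close>

lemma jensen_bounded:
  assumes "\<rho> > 0"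
  shows "\<exists>N' M. \<forall>n\<ge>N'. \<forall>z w. norm z \<le> \<rho> \<longrightarrow> norm w \<le> \<rho> \<longrightarrow> norm (eval2 (jensen_poly c n) z w) \<le> M"
proof -
  \<comment> \<open>For |v| \<le> \<rho> and |t| \<le> 1 the point v + iR + t has imaginary part at
    least R - \<rho> - 1 = 1 and norm at most \<open>S\<close>.\<close>
  define R where "R = \<rho> + 2"
  define S where "S = \<rho> + R + 1"
  define K where "K = cball (0::complex) S \<inter> {z. Im z \<ge> 1}"
  have "S > 0" using assms by (simp add: S_def R_def)
  have K: "compact K" "K \<subseteq> {z. Im z > 0}"
    unfolding K_def by (auto intro!: compact_Int_closed closed_halfspace_Im_ge)
  let ?P = "\<lambda>n zw. eval2 (jensen_poly c n) (fst zw) (snd zw)"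
  have lim: "uniform_limit (K \<times> K) ?P (w_series c) sequentially"
    by (rule uniform_limit_on_subset[OF jensen_converges_half_plane(2)[OF K \<open>S > 0\<close>]]) (auto simp: K_def)
  have KK: "compact (K \<times> K)" using K(1) by (intro compact_Times)
  have "continuous_on (K \<times> K) (w_series c)"
    by (rule uniform_limit_theorem[OF _ lim]) (auto intro: continuous_on_eval2 always_eventually)
  then have cn: "continuous_on (K \<times> K) (\<lambda>x. norm (w_series c x))" by (intro continuous_intros)
  have "\<i> \<in> K" using assms by (auto simp: K_def S_def R_def)
  then have ne: "K \<times> K \<noteq> {}" by blast
  obtain x0 where x0: "x0 \<in> K \<times> K" "\<And>x. x \<in> K \<times> K \<Longrightarrow> norm (w_series c x0) \<le> norm (w_series c x)"
    using continuous_attains_inf[OF KK ne cn] by blast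
  obtain x1 where x1: "\<And>x. x \<in> K \<times> K \<Longrightarrow> norm (w_series c x) \<le> norm (w_series c x1)"
    using continuous_attains_sup[OF KK ne cn] by blast
  \<comment> \<open>Half the minimum of the limit: an error below \<delta> still leaves a norm of at
    least \<delta>.\<close>
  define \<delta> where "\<delta> = norm (w_series c x0) / 2"
  define M where "M = norm (w_series c x1) + \<delta>"
  have "w_series c (fst x0, snd x0) \<noteq> 0" using x0(1) K(2) by (intro w_series_nonzero) auto
  then have \<delta>: "\<delta> > 0" by (simp add: \<delta>_def)
  have "\<forall>\<^sub>F n in sequentially. \<forall>x\<in>K \<times> K. dist (?P n x) (w_series c x) < \<delta>"
    using lim \<delta> by (rule uniform_limitD)
  then obtain N' where N': "\<And>n x. n \<ge> N' \<Longrightarrow> x \<in> K \<times> K \<Longrightarrow> dist (?P n x) (w_series c x) < \<delta>"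
    unfolding eventually_sequentially by blast
  have bnd: "norm (?P n x) \<ge> \<delta>" "norm (?P n x) \<le> M" if "n \<ge> N'" "x \<in> K \<times> K" for n x
  proof -
    have "2 * \<delta> \<le> norm (w_series c x)" using x0(2)[OF that(2)] by (simp add: \<delta>_def)
    then show "norm (?P n x) \<ge> \<delta>" "norm (?P n x) \<le> M"
      using N'[OF that] x1[OF that(2)] norm_triangle_ineq2[of "w_series c x" "?P n x"]
        norm_triangle_ineq2[of "?P n x" "w_series c x"]
      by (auto simp: M_def dist_norm norm_minus_commute)
  qed
  have shift: "v + \<i> * R + t \<in> K" if "norm v \<le> \<rho>" "norm t \<le> 1" for v t
  proof -
    have "norm (v + \<i> * R + t) \<le> norm v + norm (\<i> * complex_of_real R) + norm t"
      by (intro norm_triangle_le add_mono) auto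
    moreover have "norm (\<i> * complex_of_real R) = R" using assms by (simp add: norm_mult R_def)
    ultimately show ?thesis
      using that assms abs_Im_le_cmod[of v] abs_Im_le_cmod[of t] by (auto simp: K_def S_def R_def)
  qed
  have "norm (eval2 (jensen_poly c n) z w) \<le> M * exp (M / \<delta> * R + (3 * (M / \<delta>)\<^sup>2 + 2 * (M / \<delta>)) / 2 * R\<^sup>2)"
    if n: "n \<ge> max N N'" and z: "norm z \<le> \<rho>" and w: "norm w \<le> \<rho>" for n z w
  proof (rule stable2_diagonal_bound[OF _ _ _ _ \<delta>])
    show "stable2 (jensen_poly c n)" using stab n by simp
    show "Im z + R > 0" "Im w + R > 0" "R \<ge> 0"
      using assms z w abs_Im_le_cmod[of z] abs_Im_le_cmod[of w] by (auto simp: R_def)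
    show "\<delta> \<le> norm (eval2 (jensen_poly c n) (z + \<i> * R) (w + \<i> * R))"
      using bnd(1)[of n "(z + \<i> * R, w + \<i> * R)"] n shift[OF z, of 0] shift[OF w, of 0] by simp
    show "norm (eval2 (jensen_poly c n) (z + \<i> * R + t) (w + \<i> * R + t)) \<le> M" if "norm t \<le> 1" for t
      using bnd(2)[of n "(z + \<i> * R + t, w + \<i> * R + t)"] n shift[OF z that] shift[OF w that] by simp
  qed
  then show ?thesis by blast
qed

text \<open>With bounds on all bidiscs available, the convergence argument runs with K a full disc
  of the z plane instead of a part of the half plane.\<close>

theorem w_series_in_stable2_closure:
  "w_series c \<in> stable2_closure" "(\<lambda>k. poly (c k) z * w ^ k) sums w_series c (z, w)"
proof -
  have *: "(\<forall>z\<in>cball 0 \<rho>. \<forall>w\<in>cball 0 \<rho>. summable (\<lambda>k. poly (c k) z * w ^ k)) \<and>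
     uniform_limit (cball 0 \<rho> \<times> cball 0 \<rho>) (\<lambda>n zw. eval2 (jensen_poly c n) (fst zw) (snd zw)) (w_series c) sequentially"
    if \<rho>: "\<rho> > 0" for \<rho>
  proof -
    have "2 * \<rho> > 0" using \<rho> by simp
    then obtain N' M where M: "\<forall>n\<ge>N'. \<forall>z w. norm z \<le> 2 * \<rho> \<longrightarrow> norm w \<le> 2 * \<rho> \<longrightarrow> norm (eval2 (jensen_poly c n) z w) \<le> M"
      using jensen_bounded by meson
    have bd: "norm (eval2 (jensen_poly c n) z w) \<le> M" if "n \<ge> N'" "z \<in> cball 0 \<rho>" "norm w \<le> 2 * \<rho>" for n z w
      using that \<rho> M by simp
    show ?thesis
      using summable_w_series[of \<rho> N' "cball 0 \<rho>" c M, OF \<rho> bd] uniform_limit_jensen_poly[of \<rho> N' "cball 0 \<rho>" c M, OF \<rho> bd]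
      by simp
  qed
  have "summable (\<lambda>k. poly (c k) z * w ^ k)"
    using *[of "max 1 (max (norm z) (norm w))"] by auto
  then show "(\<lambda>k. poly (c k) z * w ^ k) sums w_series c (z, w)" by (simp add: summable_sums)
  have "uniform_limit L (\<lambda>n zw. eval2 (jensen_poly c (n + N)) (fst zw) (snd zw)) (w_series c) sequentially"
    if L: "compact L" for L
  proof -
    obtain \<rho> where \<rho>: "\<rho> > 0" "L \<subseteq> cball 0 \<rho>"
      using bounded_subset_ballD[OF compact_imp_bounded[OF L], of 0] ball_subset_cball by blast
    have "L \<subseteq> cball 0 \<rho> \<times> cball 0 \<rho>"
    proof
      fix x assume "x \<in> L"
      then have "norm (fst x) \<le> \<rho>" "norm (snd x) \<le> \<rho>"
        using \<rho>(2) norm_fst_le[of "fst x" "snd x"] norm_snd_le[of "snd x" "fst x"] by fastforce+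
      then show "x \<in> cball 0 \<rho> \<times> cball 0 \<rho>" by (simp add: mem_Times_iff)
    qed
    then have "uniform_limit L (\<lambda>n zw. eval2 (jensen_poly c n) (fst zw) (snd zw)) (w_series c) sequentially"
      using *[OF \<rho>(1)] uniform_limit_on_subset by blast
    then show ?thesis
      by (auto simp: uniform_limit_iff intro: eventually_sequentially_seg[THEN iffD2])
  qed
  then show "w_series c \<in> stable2_closure"
    unfolding stable2_closure_def using stab by (intro CollectI exI[of _ "\<lambda>n. jensen_poly c (n + N)"]) auto
qed

end

section \<open>The dichotomy for stability preservers\<close>

lemma stable1_smult_iff: "a \<noteq> 0 \<Longrightarrow> stable1 (smult a p) \<longleftrightarrow> stable1 p"
  by (auto simp: stable1_def)

lemma Im_one_divide_neg:
  assumes "Im u > 0" shows "Im (1 / u) < 0"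
proof -
  have "(Re u)\<^sup>2 + (Im u)\<^sup>2 > 0" using assms by (simp add: sum_power2_gt_zero_iff)
  then show ?thesis using assms by (simp add: Im_divide divide_neg_pos)
qed

lemma one_minus_mult_nonzero:
  assumes "Im u > 0" "Im x \<ge> 0" shows "1 - u * x \<noteq> 0"
proof
  assume "1 - u * x = 0"
  moreover have "u \<noteq> 0" using assms(1) by auto
  ultimately have "x = 1 / u" by (simp add: field_simps)
  then show False using Im_one_divide_neg[OF assms(1)] assms(2) by simp
qed

lemma stable1_linear_power:
  assumes "Im u > 0" shows "stable1 ([:1, -u:] ^ n)"
  using one_minus_mult_nonzero[OF assms] by (auto simp: stable1_def poly_power mult.commute)

text \<open>The zero 1/u lies at a positive distance \<beta> below the real line, so on the closed
  upper half plane g is dominated by a multiple of |x - 1/u|^n, including near infinity.\<close>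

lemma stable1_perturb_linear_power:
  fixes g :: "complex poly"
  assumes u: "Im u > 0" and g: "degree g \<le> n"
  shows "\<exists>e. e \<noteq> 0 \<and> stable1 ([:1, -u:] ^ n + smult e g)"
proof -
  have "u \<noteq> 0" using u by auto
  define \<beta> where "\<beta> = - Im (1 / u)"
  have "\<beta> > 0" using Im_one_divide_neg[OF u] by (simp add: \<beta>_def)
  \<comment> \<open>Expanding g about 1/u allows each |y|^k to be compared with |y|^n, as |y| \<ge>
    \<beta>.\<close>
  define h where "h = pcompose g [:1 / u, 1:]"
  have dh: "degree h \<le> n" using g by (simp add: h_def degree_pcompose)
  define C where "C = (\<Sum>k\<le>n. norm (coeff h k) / \<beta> ^ (n - k))"
  have "C \<ge> 0" unfolding C_def using \<open>\<beta> > 0\<close> by (intro sum_nonneg) auto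
  have bound: "norm (poly g x) \<le> C * norm (x - 1 / u) ^ n" if "Im x \<ge> 0" for x
  proof -
    define y where "y = x - 1 / u"
    have "\<beta> \<le> norm y" using that abs_Im_le_cmod[of y] by (simp add: \<beta>_def y_def)
    have "poly g x = poly h y" by (simp add: h_def poly_pcompose y_def)
    also have "\<dots> = (\<Sum>k\<le>n. coeff h k * y ^ k)"
      unfolding poly_altdef using dh by (intro sum.mono_neutral_left) (auto simp: coeff_eq_0)
    also have "norm \<dots> \<le> (\<Sum>k\<le>n. norm (coeff h k) / \<beta> ^ (n - k) * norm y ^ n)"
    proof (rule sum_norm_le)
      fix k assume "k \<in> {..n}"
      then have "norm y ^ n = norm y ^ (n - k) * norm y ^ k" by (simp flip: power_add)
      moreover have "\<beta> ^ (n - k) * norm y ^ k \<le> norm y ^ (n - k) * norm y ^ k"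
        using \<open>\<beta> \<le> norm y\<close> \<open>\<beta> > 0\<close> by (intro mult_right_mono power_mono) auto
      ultimately have "norm y ^ k \<le> norm y ^ n / \<beta> ^ (n - k)"
        using \<open>\<beta> > 0\<close> by (simp add: field_simps)
      then have "norm (coeff h k) * norm y ^ k \<le> norm (coeff h k) * (norm y ^ n / \<beta> ^ (n - k))"
        by (intro mult_left_mono) auto
      then show "norm (coeff h k * y ^ k) \<le> norm (coeff h k) / \<beta> ^ (n - k) * norm y ^ n"
        by (simp add: norm_mult norm_power)
    qed
    also have "\<dots> = C * norm y ^ n" by (simp add: C_def sum_distrib_right)
    finally show ?thesis by (simp add: y_def)
  qed
  \<comment> \<open>The perturbation is then at most C/(C + 1) < 1 times |1 - ux|^n; adding 1 keeps
    the quotient defined when C = 0.\<close>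
  define e where "e = norm u ^ n / (C + 1)"
  have "e > 0" using \<open>C \<ge> 0\<close> \<open>u \<noteq> 0\<close> by (simp add: e_def)
  have nz: "poly ([:1, -u:] ^ n + smult (of_real e) g) x \<noteq> 0" if "Im x \<ge> 0" for x
  proof
    assume "poly ([:1, -u:] ^ n + smult (of_real e) g) x = 0"
    then have "(1 - u * x) ^ n = - (of_real e * poly g x)"
      by (simp add: poly_power mult.commute eq_neg_iff_add_eq_0)
    then have "norm (1 - u * x) ^ n = e * norm (poly g x)"
      using \<open>e > 0\<close> by (simp add: norm_mult flip: norm_power)
    also have "\<dots> \<le> e * (C * norm (x - 1 / u) ^ n)"
      using bound[OF that] \<open>e > 0\<close> by (intro mult_left_mono) auto
    also have "\<dots> = C / (C + 1) * norm (u * (x - 1 / u)) ^ n"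
      by (simp add: e_def norm_mult power_mult_distrib)
    also have "norm (u * (x - 1 / u)) = norm (1 - u * x)"
      using \<open>u \<noteq> 0\<close> by (simp add: algebra_simps norm_minus_commute)
    finally have "norm (1 - u * x) ^ n \<le> C / (C + 1) * norm (1 - u * x) ^ n" .
    moreover have "C / (C + 1) * norm (1 - u * x) ^ n < 1 * norm (1 - u * x) ^ n"
      using \<open>C \<ge> 0\<close> one_minus_mult_nonzero[OF u that] by (intro mult_strict_right_mono) auto
    ultimately show False by simp
  qed
  have "poly ([:1, -u:] ^ n + smult (of_real e) g) \<i> \<noteq> 0" by (rule nz) simp
  then have "[:1, -u:] ^ n + smult (of_real e) g \<noteq> 0" by (metis poly_0)
  then have "stable1 ([:1, -u:] ^ n + smult (of_real e) g)" using nz by (simp add: stable1_def)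
  then show ?thesis using \<open>e > 0\<close> by (intro exI[of _ "of_real e"]) auto
qed

text \<open>Subtracting the right multiple of T g from T f yields an element of the range that
  vanishes at \<i>, so it is not stable and must be 0.\<close>

lemma linear_space_of_stable_rank_le_1:
  assumes T: "linear_op T" and st: "\<And>g. stable1 (T g) \<or> T g = 0"
  shows "\<exists>\<alpha> P. linear_functional \<alpha> \<and> stable1 P \<and> (\<forall>f. T f = smult (\<alpha> f) P)"
proof (cases "\<forall>f. T f = 0")
  case True
  \<comment> \<open>\<open>P\<close> has to be stable even for the zero operator, so the constant 1
    is taken with the zero functional.\<close>
  then show ?thesis
    by (intro exI[of _ "\<lambda>_. 0"] exI[of _ 1]) (auto simp: linear_functional_def stable1_def)
next
  case False
  then obtain g where g: "T g \<noteq> 0" by blast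
  then have P: "stable1 (T g)" using st by blast
  then have gi: "poly (T g) \<i> \<noteq> 0" by (simp add: stable1_def)
  define \<alpha> where "\<alpha> f = poly (T f) \<i> / poly (T g) \<i>" for f
  have "linear_functional \<alpha>"
    using T by (simp add: linear_functional_def linear_op_def \<alpha>_def add_divide_distrib)
  moreover have "T f = smult (\<alpha> f) (T g)" for f
  proof -
    have "T (f + smult (- \<alpha> f) g) = T f + smult (- \<alpha> f) (T g)"
      using T by (simp only: linear_op_def)
    moreover have "poly (T f + smult (- \<alpha> f) (T g)) \<i> = 0" using gi by (simp add: \<alpha>_def)
    ultimately have "T f + smult (- \<alpha> f) (T g) = 0"
      using st[of "f + smult (- \<alpha> f) g"] by (auto simp: stable1_def)
    then show ?thesis by (simp add: add_eq_0_iff)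
  qed
  ultimately show ?thesis using P by blast
qed

section \<open>Reduction to Jensen polynomials of the symbol\<close>

definition symbol_coeff :: "(complex poly \<Rightarrow> complex poly) \<Rightarrow> nat \<Rightarrow> complex poly" where
  "symbol_coeff T k = smult ((-1) ^ k / fact k) (T (monom 1 k))"

text \<open>The binomial theorem. A bivariate question about the symbol becomes one about
  \<open>T\<close> on one-variable polynomials with parameter w.\<close>

lemma poly_op_linear_power:
  assumes T: "linear_op T"
  shows "poly (T ([:1, -(w / of_nat n):] ^ n)) z = eval2 (jensen_poly (symbol_coeff T) n) z w"
proof -
  have "degree ([:1, -(w / of_nat n):] ^ n) \<le> n"
    by (rule order_trans[OF degree_power_le]) simp
  from linear_op_conv_sum[OF T this]
  have "poly (T ([:1, -(w / of_nat n):] ^ n)) z =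
     (\<Sum>k\<le>n. of_nat (n choose k) * (- (w / of_nat n)) ^ k * poly (T (monom 1 k)) z)"
    by (simp add: poly_sum coeff_linear_poly_power)
  also have "\<dots> = (\<Sum>k\<le>n. of_real (falling_ratio n k) * ((-1) ^ k / fact k) * poly (T (monom 1 k)) z * w ^ k)"
  proof (intro sum.cong refl)
    fix k
    have "(- (w / of_nat n)) ^ k = (-1) ^ k * w ^ k / of_nat n ^ k"
      by (subst power_minus) (simp add: power_divide)
    then show "of_nat (n choose k) * (- (w / of_nat n)) ^ k * poly (T (monom 1 k)) z =
      of_real (falling_ratio n k) * ((-1) ^ k / fact k) * poly (T (monom 1 k)) z * w ^ k"
      by (simp add: falling_ratio_def)
  qed
  also have "\<dots> = eval2 (jensen_poly (symbol_coeff T) n) z w"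
    by (simp add: eval2_conv_poly jensen_poly_def poly_sum poly_monom symbol_coeff_def mult.assoc)
  finally show ?thesis .
qed

text \<open>For a preserver, T[(1 - xw/n)^n] with Im w > 0 has a zero in the upper half plane only
  if it is 0; the cases are whether this occurs for arbitrarily large n.\<close>

lemma stability_preserver_dichotomy:
  assumes T: "linear_op T" and pres: "\<And>f. stable1 f \<Longrightarrow> stable1 (T f) \<or> T f = 0"
  shows "(\<forall>g. stable1 (T g) \<or> T g = 0) \<or> (\<exists>N. \<forall>n\<ge>N. stable2 (jensen_poly (symbol_coeff T) n))"
proof (cases "\<forall>N. \<exists>n\<ge>N. \<exists>u. Im u > 0 \<and> T ([:1, -u:] ^ n) = 0")
  case True
  have "stable1 (T g) \<or> T g = 0" for g
  proof -
    obtain n u where n: "n \<ge> degree g" "Im u > 0" "T ([:1, -u:] ^ n) = 0" using True by blast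
    obtain e where e: "e \<noteq> 0" "stable1 ([:1, -u:] ^ n + smult e g)"
      using stable1_perturb_linear_power[OF n(2,1)] by blast
    \<comment> \<open>As \<open>T\<close> kills the power, the image of this stable polynomial is a
      nonzero multiple of T g.\<close>
    have "T ([:1, -u:] ^ n + smult e g) = T ([:1, -u:] ^ n) + smult e (T g)"
      using T unfolding linear_op_def by metis
    then have "T ([:1, -u:] ^ n + smult e g) = smult e (T g)" using n(3) by simp
    then show ?thesis using pres[OF e(2)] e(1) by (simp add: stable1_smult_iff)
  qed
  then show ?thesis by blast
next
  case False
  then obtain N where N: "\<And>n u. n \<ge> N \<Longrightarrow> Im u > 0 \<Longrightarrow> T ([:1, -u:] ^ n) \<noteq> 0" by blast
  \<comment> \<open>n \<ge> 1 ensures that w/n stays in the open upper half plane.\<close>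
  have "stable2 (jensen_poly (symbol_coeff T) n)" if n: "n \<ge> max N 1" for n
  proof -
    have nz: "eval2 (jensen_poly (symbol_coeff T) n) z w \<noteq> 0" if "Im z > 0" "Im w > 0" for z w
    proof -
      have u: "Im (w / of_nat n) > 0" using that(2) n by (simp add: Im_divide_of_nat)
      then have "stable1 (T ([:1, -(w / of_nat n):] ^ n))"
        using N[OF _ u, of n] n pres[OF stable1_linear_power[OF u, of n]] by auto
      then show ?thesis using that(1) by (simp add: stable1_def poly_op_linear_power[OF T])
    qed
    moreover have "jensen_poly (symbol_coeff T) n \<noteq> 0"
      using nz[of "\<i>" "\<i>"] by (auto simp: eval2_def)
    ultimately show ?thesis by (simp add: stable2_def)
  qed
  then show ?thesis by blast
qed

theorem mainTheorem7:
  fixes T :: "complex poly \<Rightarrow> complex poly"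
  assumes "linear_op T"
  shows "(\<forall>f. stable1 f \<longrightarrow> stable1 (T f) \<or> T f = 0) \<longleftrightarrow>
         ((\<exists>\<alpha> P. linear_functional \<alpha> \<and> stable1 P \<and> (\<forall>f. T f = smult (\<alpha> f) P))
          \<or> GT_in_closure T)"
proof
  assume pres: "\<forall>f. stable1 f \<longrightarrow> stable1 (T f) \<or> T f = 0"
  show "(\<exists>\<alpha> P. linear_functional \<alpha> \<and> stable1 P \<and> (\<forall>f. T f = smult (\<alpha> f) P)) \<or> GT_in_closure T"
  proof (cases "\<forall>g. stable1 (T g) \<or> T g = 0")
    case True
    then show ?thesis using linear_space_of_stable_rank_le_1[OF assms] by blast
  next
    case False
    let ?c = "symbol_coeff T"
    obtain N where N: "\<And>n. n \<ge> N \<Longrightarrow> stable2 (jensen_poly ?c n)"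
      using stability_preserver_dichotomy[OF assms] pres False by blast
    have "\<exists>k. ?c k \<noteq> 0"
    proof (rule ccontr)
      assume "\<nexists>k. ?c k \<noteq> 0"
      then have "jensen_poly ?c N = 0" by (simp add: jensen_poly_def)
      then show False using N[of N] by (simp add: stable2_def)
    qed
    define m where "m = (LEAST k. ?c k \<noteq> 0)"
    have m: "?c m \<noteq> 0" "\<And>k. k < m \<Longrightarrow> ?c k = 0"
      using LeastI_ex[OF \<open>\<exists>k. ?c k \<noteq> 0\<close>] not_less_Least unfolding m_def by blast+
    \<comment> \<open>The monomial x^m is stable, so preservation makes the first nonzero
      coefficient of the symbol stable, as the bounds require.\<close>
    have "T (monom 1 m) \<noteq> 0" using m(1) by (auto simp: symbol_coeff_def)
    moreover have "stable1 (monom 1 m)" by (auto simp: stable1_def poly_monom)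
    ultimately have "stable1 (T (monom 1 m))" using pres by blast
    then have cm: "stable1 (?c m)" unfolding symbol_coeff_def by (subst stable1_smult_iff) auto
    have "GT_term T z w = (\<lambda>k. poly (?c k) z * w ^ k)" for z w
      by (auto simp: GT_term_def symbol_coeff_def)
    then have "GT_in_closure T"
      unfolding GT_in_closure_def
      using w_series_in_stable2_closure[where N = N, OF N m(2) cm]
      by (intro bexI[where x = "w_series ?c"]) auto
    then show ?thesis ..
  qed
next
  assume "(\<exists>\<alpha> P. linear_functional \<alpha> \<and> stable1 P \<and> (\<forall>f. T f = smult (\<alpha> f) P)) \<or> GT_in_closure T"
  then show "\<forall>f. stable1 f \<longrightarrow> stable1 (T f) \<or> T f = 0"
  proof
    assume "\<exists>\<alpha> P. linear_functional \<alpha> \<and> stable1 P \<and> (\<forall>f. T f = smult (\<alpha> f) P)"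
    then obtain \<alpha> P where P: "stable1 P" "\<And>f. T f = smult (\<alpha> f) P" by blast
    show ?thesis
    proof (intro allI impI)
      fix f show "stable1 (T f) \<or> T f = 0"
        unfolding P(2) using P(1) by (cases "\<alpha> f = 0") (auto simp: stable1_smult_iff)
    qed
  qed (use GT_in_closure_imp_stable[OF assms] in blast)
qed

end
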